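(* Let $(a_1,a_2,b_1,b_2,r)$ be the 5-tuple of a Buchsbaum curve of diameter one in $\mathbb P^3$, and let $\hat a_2=\max\{0,a_2-b_2\}$ and $\hat b_1=\max\{0,b_1-a_1\}$. The number of minimal 5-tuples that specialize to $(a_1,a_2,b_1,b_2,r)$ is $$N_B+N_{CM}.$$ Here $$N_B=\binom{r-\hat b_1-\hat a_2+1}{2}-\binom{r-b_1-\hat a_2}{2}-\binom{r-\hat b_1-a_2}{2}+\binom{r-b_1-a_2-1}{2}$$ is the number of minimal 5-tuples that correspond to generic diameter-1 curves (those with non-zero last entry), and $$N_{CM}=\begin{cases}\min\{b_1,a_2,r\}+1,&\text{if } r\le\max\{b_1,a_2\},\\ b_1+a_2-r+1,&\text{if }\max\{b_1,a_2\}\le r\le b_1+a_2,\\ 0,&\text{if } r>b_1+a_2\end{cases}$$ is the number of minimal 5-tuples that correspond to generic ACM curves (those with last entry zero).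
   Context: Convention: $\binom mn=0$ if $m<n$ (in particular for negative $m$). $k$ is an algebraically closed field, $R=k[X_0,X_1,X_2,X_3]$ with its standard grading. A curve is an equidimensional, locally Cohen-Macaulay closed one-dimensional subscheme $C$ of $\mathbb P^3=\mathrm{Proj}(R)$, with ideal sheaf $\mathcal I_C$; $I(C)=\bigoplus_vH^0(\mathcal I_C(v))$. $C$ is ACM if $H^1(\mathcal I_C(v))=0$ for all $v$, and has diameter one (and is then automatically Buchsbaum) if $H^1(\mathcal I_C(v))\ne0$ for exactly one integer $v$, denoted $c$. The 5-tuple of a diameter-1 curve is $(a_1,a_2,b_1,b_2,r)=(\beta_{1,c+4},\beta_{1,c},\beta_{2,c+4},\beta_{2,c},\beta_{3,c+4})$, where the minimal graded free resolution of $I(C)$ is $0\to\bigoplus_i R(-i)^{\beta_{3,i}}\to\bigoplus_i R(-i)^{\beta_{2,i}}\to\bigoplus_i R(-i)^{\beta_{1,i}}\to I(C)\to0$. One has $r=h^1(\mathcal I_C(c))$. Operations on 5-tuples of non-negative integers: subtracting one of the vectors $(0,0,1,0,1)$, $(0,1,0,0,1)$, $(0,1,0,1,0)$, $(1,0,1,0,0)$, allowed only if the result has non-negative entries. A 5-tuple $\underline\beta'_5$ specializes to $(a_1,a_2,b_1,b_2,r)$ if it is obtained from $(a_1,a_2,b_1,b_2,r)$ by repeatedly (possibly zero times) applying these operations in some order. A 5-tuple is minimal if none of the four operations can be applied to it. The minimal 5-tuples specializing to the 5-tuple of $C$ correspond bijectively to the irreducible components of the Hilbert scheme $\mathrm H(d,g)$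 containing $C$, each component corresponding to the 5-tuple (with the same $c$) of its generic curve; the last entry of that 5-tuple is $h^1(\mathcal I(c))$ of the generic curve, which is thus a diameter-1 curve if the entry is non-zero and ACM if it is zero. *)

theory Defs
  imports
    "HOL-Library.Numeral_Type"
    "HOL-Library.Poly_Mapping"
    "HOL-Library.Extended_Nat"
    "HOL-Computational_Algebra.Polynomial"
    "HOL-Computational_Algebra.Fraction_Field"
    "HOL-Algebra.QuotRing"
    "HOL-Algebra.Ring_Divisibility"
    "Jordan_Normal_Form.Matrix"
begin

section \<open>The graded ring $R = k[X_0,X_1,X_2,X_3]$\<close>

text \<open>Monomials are exponent vectors indexed by the four-element type \<open>4\<close>, whose elements are
  \<open>0, 1, 2, 3\<close>. Degrees are integers because twists and degrees of syzygies are.\<close>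

type_synonym 'k R4 = "(4 \<Rightarrow>\<^sub>0 nat) \<Rightarrow>\<^sub>0 'k"

definition X :: "4 \<Rightarrow> 'k::field R4" where
  "X i = Poly_Mapping.single (Poly_Mapping.single i 1) 1"

definition mon_degree :: "(4 \<Rightarrow>\<^sub>0 nat) \<Rightarrow> int" where
  "mon_degree m = (\<Sum>i\<in>UNIV. int (Poly_Mapping.lookup m i))"

text \<open>The graded piece $R_d$; it contains $0$ for every $d$ and is $\{0\}$ for $d < 0$.\<close>

definition graded_piece :: "int \<Rightarrow> 'k::field R4 set" where
  "graded_piece d = {f. \<forall>m\<in>Poly_Mapping.keys f. mon_degree m = d}"

definition hom_component :: "int \<Rightarrow> 'k::field R4 \<Rightarrow> 'k R4" where
  "hom_component d f =
     (\<Sum>m | m \<in> Poly_Mapping.keys f \<and> mon_degree m = d. Poly_Mapping.single m (Poly_Mapping.lookup f m))"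

definition irrelevant_ideal :: "'k::field R4 set" where
  "irrelevant_ideal = {f. \<forall>m\<in>Poly_Mapping.keys f. mon_degree m > 0}"

definition R_ring :: "'k::field R4 ring" where
  "R_ring = \<lparr>carrier = UNIV, mult = (*), one = 1, zero = 0, add = (+)\<rparr>"

definition homogeneous_ideal :: "'k::field R4 set \<Rightarrow> bool" where
  "homogeneous_ideal J \<longleftrightarrow> ideal J R_ring \<and> (\<forall>f\<in>J. \<forall>d. hom_component d f \<in> J)"


section \<open>Dimension, depth and Cohen--Macaulay local rings\<close>

text \<open>The supremum of the lengths \<open>n\<close> of chains \<open>W 0 \<subset> \<dots> \<subset> W n\<close> in a family of sets.\<close>

definition chain_dim :: "'a set set \<Rightarrow> enat" where
  "chain_dim F =
     Sup {enat n |n. \<exists>W. (\<forall>i\<le>n. W i \<in> F) \<and> (\<forall>i<n. W i \<subset> W (Suc i))}"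

definition krull_dim :: "('a, 'b) ring_scheme \<Rightarrow> enat" where
  "krull_dim A = chain_dim {P. primeideal P A}"

definition regular_sequence :: "('a, 'b) ring_scheme \<Rightarrow> 'a list \<Rightarrow> bool" where
  "regular_sequence A xs \<longleftrightarrow>
     set xs \<subseteq> carrier A \<and>
     (\<forall>i<length xs. \<forall>y\<in>carrier A.
        xs ! i \<otimes>\<^bsub>A\<^esub> y \<in> genideal A (set (take i xs)) \<longrightarrow> y \<in> genideal A (set (take i xs))) \<and>
     genideal A (set xs) \<noteq> carrier A"

definition is_local_ring :: "('a, 'b) ring_scheme \<Rightarrow> bool" where
  "is_local_ring A \<longleftrightarrow> cring A \<and> ideal (carrier A - Units A) A"

text \<open>For a local ring, whose maximal ideal is the set of non-units.\<close>

definition local_depth :: "('a, 'b) ring_scheme \<Rightarrow> enat" where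
  "local_depth A =
     Sup {enat (length xs) |xs. set xs \<subseteq> carrier A - Units A \<and> regular_sequence A xs}"

definition cohen_macaulay_local_ring :: "('a, 'b) ring_scheme \<Rightarrow> bool" where
  "cohen_macaulay_local_ring A \<longleftrightarrow>
     is_local_ring A \<and> noetherian_ring A \<and> local_depth A = krull_dim A"


section \<open>Closed subschemes of $\mathrm{Proj}(R)$\<close>

text \<open>A closed subscheme $C$ of $\mathbb P^3$ is given by a homogeneous ideal $J$ of $R$, as
  $C = \mathrm{Proj}(R/J)$ with ideal sheaf $\mathcal I_C = \tilde J$. Every closed subscheme
  is of this form. $J$ is not required to be saturated: all notions below depend only
  on $\tilde J$, and $I(C)$ is computed from $\tilde J$.\<close>

definition Proj :: "'k::field R4 set set" where
  "Proj = {P. primeideal P R_ring \<and> homogeneous_ideal P \<and> \<not> irrelevant_ideal \<subseteq> P}"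

definition proj_zeros :: "'k::field R4 set \<Rightarrow> 'k R4 set set" where
  "proj_zeros J = {P \<in> Proj. J \<subseteq> P}"

definition proj_closed :: "'k::field R4 set set \<Rightarrow> bool" where
  "proj_closed Z \<longleftrightarrow> (\<exists>J. homogeneous_ideal J \<and> Z = proj_zeros J)"

definition irreducible_closed :: "'k::field R4 set set \<Rightarrow> bool" where
  "irreducible_closed Z \<longleftrightarrow>
     proj_closed Z \<and> Z \<noteq> {} \<and>
     (\<forall>Z1 Z2. proj_closed Z1 \<and> proj_closed Z2 \<and> Z = Z1 \<union> Z2 \<longrightarrow> Z = Z1 \<or> Z = Z2)"

definition irreducible_component :: "'k::field R4 set set \<Rightarrow> 'k R4 set set \<Rightarrow> bool" where
  "irreducible_component Z Y \<longleftrightarrow>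
     irreducible_closed Z \<and> Z \<subseteq> Y \<and>
     (\<forall>Z'. irreducible_closed Z' \<and> Z \<subseteq> Z' \<and> Z' \<subseteq> Y \<longrightarrow> Z' = Z)"

definition top_dim :: "'k::field R4 set set \<Rightarrow> enat" where
  "top_dim Z = chain_dim {W. irreducible_closed W \<and> W \<subseteq> Z}"

text \<open>The stalks $\mathcal O_{\mathbb P^3,P} = R_{(P)}$ and $\mathcal I_{C,P} = J_{(P)}$, as
  subsets of the fraction field of $R$.\<close>

definition stalk_of :: "'k::field R4 set \<Rightarrow> 'k R4 set \<Rightarrow> 'k R4 fract set" where
  "stalk_of J P =
     {Fract f g |f g d. f \<in> J \<and> g \<notin> P \<and> f \<in> graded_piece d \<and> g \<in> graded_piece d}"

definition stalk_P3 :: "'k::field R4 set \<Rightarrow> 'k R4 fract ring" where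
  "stalk_P3 P = \<lparr>carrier = stalk_of UNIV P, mult = (*), one = 1, zero = 0, add = (+)\<rparr>"

definition stalk_C :: "'k::field R4 set \<Rightarrow> 'k R4 set \<Rightarrow> 'k R4 fract set ring" where
  "stalk_C J P = stalk_P3 P Quot stalk_of J P"

definition is_curve :: "'k::field R4 set \<Rightarrow> bool" where
  "is_curve J \<longleftrightarrow>
     homogeneous_ideal J \<and> proj_zeros J \<noteq> {} \<and>
     (\<forall>Z. irreducible_component Z (proj_zeros J) \<longrightarrow> top_dim Z = 1) \<and>
     (\<forall>P\<in>proj_zeros J. cohen_macaulay_local_ring (stalk_C J P))"


section \<open>Cohomology of the twisted ideal sheaf\<close>

text \<open>Sections of $\mathcal I_C(v)$ over $D_+(s)$, for a nonzero homogeneous \<open>s\<close>, i.e. the degree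
  $v$ part of the localization $J_s$.\<close>

definition sections :: "'k::field R4 set \<Rightarrow> int \<Rightarrow> 'k R4 \<Rightarrow> 'k R4 fract set" where
  "sections J v s =
     {Fract f (s ^ n) |f n d. f \<in> J \<and> s ^ n \<in> graded_piece d \<and> f \<in> graded_piece (v + d)}"

text \<open>Cohomology is that of the full Cech complex of the affine cover
  $D_+(X_0),\dots,D_+(X_3)$, with $D_+(X_i)\cap D_+(X_j) = D_+(X_iX_j)$. The indices are not
  assumed increasing; the cocycle condition makes 1-cocycles alternating.\<close>

definition H0 :: "'k::field R4 set \<Rightarrow> int \<Rightarrow> 'k R4 fract set" where
  "H0 J v = {s. \<forall>i. s \<in> sections J v (X i)}"

definition cech_Z1 :: "'k::field R4 set \<Rightarrow> int \<Rightarrow> (4 \<Rightarrow> 4 \<Rightarrow> 'k R4 fract) set" where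
  "cech_Z1 J v =
     {z. (\<forall>i j. z i j \<in> sections J v (X i * X j)) \<and>
         (\<forall>i j k. z j k - z i k + z i j = 0)}"

definition cech_B1 :: "'k::field R4 set \<Rightarrow> int \<Rightarrow> (4 \<Rightarrow> 4 \<Rightarrow> 'k R4 fract) set" where
  "cech_B1 J v = {\<lambda>i j. g j - g i |g. \<forall>i. g i \<in> sections J v (X i)}"

definition H1 :: "'k::field R4 set \<Rightarrow> int \<Rightarrow> (4 \<Rightarrow> 4 \<Rightarrow> 'k R4 fract) set monoid" where
  "H1 J v =
     \<lparr>carrier = cech_Z1 J v, mult = \<lambda>z w i j. z i j + w i j, one = \<lambda>i j. 0\<rparr> Mod cech_B1 J v"

definition H1_nonzero :: "'k::field R4 set \<Rightarrow> int \<Rightarrow> bool" where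
  "H1_nonzero J v \<longleftrightarrow> carrier (H1 J v) \<noteq> {\<one>\<^bsub>H1 J v\<^esub>}"

definition has_diameter_one :: "'k::field R4 set \<Rightarrow> bool" where
  "has_diameter_one J \<longleftrightarrow> (\<exists>!v. H1_nonzero J v)"

text \<open>$I(C) = \bigoplus_v H^0(\mathcal I_C(v))$ inside $R = \bigoplus_v H^0(\mathcal O(v))$.\<close>

definition total_ideal :: "'k::field R4 set \<Rightarrow> 'k R4 set" where
  "total_ideal J = {f. \<forall>v. Fract (hom_component v f) 1 \<in> H0 J v}"


section \<open>Minimal graded free resolutions and the 5-tuple\<close>

definition mat_image :: "'k::field R4 mat \<Rightarrow> 'k R4 vec set" where
  "mat_image A = {A *\<^sub>v x |x. x \<in> carrier_vec (dim_col A)}"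

definition mat_ker :: "'k::field R4 mat \<Rightarrow> 'k R4 vec set" where
  "mat_ker A = {x \<in> carrier_vec (dim_col A). A *\<^sub>v x = 0\<^sub>v (dim_row A)}"

text \<open>A resolution $0\to F_3\to F_2\to F_1\to I\to 0$ with $F_i = \bigoplus_q R(-D_{i,q})$, where
  \<open>\<phi> i\<close> is the matrix of $F_i\to F_{i-1}$ and $F_0 = R$, so that $F_1 \to I$ is the 1-row
  matrix \<open>\<phi> 1\<close>. It is minimal if \<open>\<phi> 2\<close> and \<open>\<phi> 3\<close> have no entry with a nonzero constant term.\<close>

definition minimal_graded_free_resolution ::
    "'k::field R4 set \<Rightarrow> (nat \<Rightarrow> int list) \<Rightarrow> (nat \<Rightarrow> 'k R4 mat) \<Rightarrow> bool" where
  "minimal_graded_free_resolution I D \<phi> \<longleftrightarrow>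
     D 0 = [0] \<and>
     (\<forall>i\<in>{1,2,3}. \<phi> i \<in> carrier_mat (length (D (i - 1))) (length (D i)) \<and>
        (\<forall>p<length (D (i - 1)). \<forall>q<length (D i).
           \<phi> i $$ (p, q) \<in> graded_piece (D i ! q - D (i - 1) ! p))) \<and>
     mat_image (\<phi> 1) = {vec 1 (\<lambda>_. f) |f. f \<in> I} \<and>
     mat_ker (\<phi> 1) = mat_image (\<phi> 2) \<and>
     mat_ker (\<phi> 2) = mat_image (\<phi> 3) \<and>
     mat_ker (\<phi> 3) = {0\<^sub>v (length (D 3))} \<and>
     (\<forall>i\<in>{2,3}. \<forall>p<length (D (i - 1)). \<forall>q<length (D i). \<phi> i $$ (p, q) \<in> irrelevant_ideal)"

text \<open>\<open>\<beta> i j\<close> is the number of summands $R(-j)$ of $F_i$. It does not depend on the choice of the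
  minimal resolution.\<close>

definition has_betti_numbers :: "'k::field R4 set \<Rightarrow> (nat \<Rightarrow> int \<Rightarrow> nat) \<Rightarrow> bool" where
  "has_betti_numbers I \<beta> \<longleftrightarrow>
     (\<exists>D \<phi>. minimal_graded_free_resolution I D \<phi> \<and>
        (\<forall>i\<in>{1,2,3}. \<forall>j. \<beta> i j = count_list (D i) j))"

type_synonym tuple5 = "nat \<times> nat \<times> nat \<times> nat \<times> nat"

definition is_five_tuple_of :: "tuple5 \<Rightarrow> 'k::field R4 set \<Rightarrow> bool" where
  "is_five_tuple_of t J \<longleftrightarrow>
     (\<exists>c \<beta>. H1_nonzero J c \<and> (\<forall>v. H1_nonzero J v \<longrightarrow> v = c) \<and>
        has_betti_numbers (total_ideal J) \<beta> \<and>
        t = (\<beta> 1 (c + 4), \<beta> 1 c, \<beta> 2 (c + 4), \<beta> 2 c, \<beta> 3 (c + 4)))"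


section \<open>Specialization of 5-tuples\<close>

text \<open>Subtraction of one of the four vectors; each rule matches exactly when the result has
  non-negative entries.\<close>

inductive reduces :: "tuple5 \<Rightarrow> tuple5 \<Rightarrow> bool" where
  "reduces (a1, a2, b1 + 1, b2, r + 1) (a1, a2, b1, b2, r)"
| "reduces (a1, a2 + 1, b1, b2, r + 1) (a1, a2, b1, b2, r)"
| "reduces (a1, a2 + 1, b1, b2 + 1, r) (a1, a2, b1, b2, r)"
| "reduces (a1 + 1, a2, b1 + 1, b2, r) (a1, a2, b1, b2, r)"

definition specializes_to :: "tuple5 \<Rightarrow> tuple5 \<Rightarrow> bool" where
  "specializes_to t' t \<longleftrightarrow> reduces\<^sup>*\<^sup>* t t'"

definition minimal_tuple :: "tuple5 \<Rightarrow> bool" where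
  "minimal_tuple t \<longleftrightarrow> \<not> (\<exists>t'. reduces t t')"

definition last_entry :: "tuple5 \<Rightarrow> nat" where
  "last_entry t = snd (snd (snd (snd t)))"

definition minimal_specializing :: "tuple5 \<Rightarrow> tuple5 set" where
  "minimal_specializing t = {t'. minimal_tuple t' \<and> specializes_to t' t}"


section \<open>The two counts\<close>

definition binom :: "int \<Rightarrow> nat \<Rightarrow> int" where
  "binom m n = (if m < int n then 0 else int (nat m choose n))"

definition N_B :: "tuple5 \<Rightarrow> int" where
  "N_B = (\<lambda>(a1, a2, b1, b2, r).
     let ha2 = max 0 (int a2 - int b2);
         hb1 = max 0 (int b1 - int a1)
     in binom (int r - hb1 - ha2 + 1) 2
        - binom (int r - int b1 - ha2) 2
        - binom (int r - hb1 - int a2) 2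
        + binom (int r - int b1 - int a2 - 1) 2)"

text \<open>The first two cases agree for $r = \max\{b_1,a_2\}$.\<close>

definition N_CM :: "tuple5 \<Rightarrow> int" where
  "N_CM = (\<lambda>(a1, a2, b1, b2, r).
     if r \<le> max b1 a2 then int (min b1 (min a2 r)) + 1
     else if r \<le> b1 + a2 then int b1 + int a2 - int r + 1
     else 0)"

end

theory Submission
  imports Defs
begin

text \<open>The four operations commute, so a specializing tuple is determined by how often each of them
  is applied: \<open>i\<close>, \<open>j\<close>, \<open>k\<close>, \<open>l\<close> times, in the order of the rules. A minimal tuple with non-zero last
  entry has vanishing second and third entries, whence \<open>l = b1 - i\<close> and \<open>k = a2 - j\<close>, and these
  tuples are the lattice points \<open>(i, j)\<close> with \<open>i + j < r\<close> of a rectangle, counted by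
  inclusion-exclusion over triangles. If the last entry is zero, then \<open>i + j = r\<close>, minimality forces
  \<open>k\<close> and \<open>l\<close> to be as large as possible, and these tuples are the lattice points of a segment.\<close>

section \<open>Specialization through multiplicities of the operations\<close>

lemma reduces_funpow:
  shows reduces_b1_r: "reduces\<^sup>*\<^sup>* (a1, a2, b1 + n, b2, r + n) (a1, a2, b1, b2, r)"
    and reduces_a2_r: "reduces\<^sup>*\<^sup>* (a1, a2 + n, b1, b2, r + n) (a1, a2, b1, b2, r)"
    and reduces_a2_b2: "reduces\<^sup>*\<^sup>* (a1, a2 + n, b1, b2 + n, r) (a1, a2, b1, b2, r)"
    and reduces_a1_b1: "reduces\<^sup>*\<^sup>* (a1 + n, a2, b1 + n, b2, r) (a1, a2, b1, b2, r)"
proof (induction n)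
  case (Suc n)
  {
    case 1
    show ?case
      using reduces.intros(1)[of a1 a2 "b1 + n" b2 "r + n"] Suc(1)
      by (simp add: converse_rtranclp_into_rtranclp)
  next
    case 2
    show ?case
      using reduces.intros(2)[of a1 "a2 + n" b1 b2 "r + n"] Suc(2)
      by (simp add: converse_rtranclp_into_rtranclp)
  next
    case 3
    show ?case
      using reduces.intros(3)[of a1 "a2 + n" b1 "b2 + n" r] Suc(3)
      by (simp add: converse_rtranclp_into_rtranclp)
  next
    case 4
    show ?case
      using reduces.intros(4)[of "a1 + n" a2 "b1 + n" b2 r] Suc(4)
      by (simp add: converse_rtranclp_into_rtranclp)
  }
qed simp_all

text \<open>Entries never increase under \<open>reduces\<close>, so every intermediate tuple
  dominates the last one and non-negativity cannot obstruct a reordering. Only the multiplicities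
  matter, and each operation can be applied in one block.\<close>

lemma specializes_to_iff:
  "specializes_to (a1', a2', b1', b2', r') (a1, a2, b1, b2, r) \<longleftrightarrow>
     (\<exists>i j k l. a1 = a1' + l \<and> a2 = a2' + j + k \<and> b1 = b1' + i + l \<and> b2 = b2' + k \<and> r = r' + i + j)"
proof
  have "\<exists>i j k l. a1 = a1' + l \<and> a2 = a2' + j + k \<and> b1 = b1' + i + l \<and> b2 = b2' + k \<and> r = r' + i + j"
    if "reduces\<^sup>*\<^sup>* t t'" "t = (a1, a2, b1, b2, r)" "t' = (a1', a2', b1', b2', r')" for t t'
    using that
  proof (induction arbitrary: a1' a2' b1' b2' r' rule: rtranclp_induct)
    case base
    then show ?case by simp
  next
    case (step s t')
    obtain c1 c2 d1 d2 q where s: "s = (c1, c2, d1, d2, q)"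
      by (cases s)
    obtain i j k l where
      eq: "a1 = c1 + l" "a2 = c2 + j + k" "b1 = d1 + i + l" "b2 = d2 + k" "r = q + i + j"
      using step.IH[OF step.prems(1) s] by blast
    from \<open>reduces s t'\<close>[unfolded s step.prems(2)] show ?case
    proof cases
      case 1
      with eq show ?thesis by (intro exI[of _ "i + 1"] exI[of _ j] exI[of _ k] exI[of _ l]) simp
    next
      case 2
      with eq show ?thesis by (intro exI[of _ i] exI[of _ "j + 1"] exI[of _ k] exI[of _ l]) simp
    next
      case 3
      with eq show ?thesis by (intro exI[of _ i] exI[of _ j] exI[of _ "k + 1"] exI[of _ l]) simp
    next
      case 4
      with eq show ?thesis by (intro exI[of _ i] exI[of _ j] exI[of _ k] exI[of _ "l + 1"]) simp
    qed
  qed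
  then show "specializes_to (a1', a2', b1', b2', r') (a1, a2, b1, b2, r) \<Longrightarrow>
    \<exists>i j k l. a1 = a1' + l \<and> a2 = a2' + j + k \<and> b1 = b1' + i + l \<and> b2 = b2' + k \<and> r = r' + i + j"
    unfolding specializes_to_def by blast
next
  assume "\<exists>i j k l. a1 = a1' + l \<and> a2 = a2' + j + k \<and> b1 = b1' + i + l \<and> b2 = b2' + k \<and> r = r' + i + j"
  then obtain i j k l where
    eq: "a1 = a1' + l" "a2 = a2' + j + k" "b1 = b1' + i + l" "b2 = b2' + k" "r = r' + i + j"
    by blast
  have "reduces\<^sup>*\<^sup>* (a1' + l, a2' + j + k, b1' + i + l, b2' + k, r' + i + j)
      (a1', a2' + j + k, b1' + i, b2' + k, r' + i + j)"
    by (rule reduces_a1_b1)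
  also have "reduces\<^sup>*\<^sup>* \<dots> (a1', a2' + j, b1' + i, b2', r' + i + j)"
    by (rule reduces_a2_b2)
  also have "reduces\<^sup>*\<^sup>* \<dots> (a1', a2', b1' + i, b2', r' + i)"
    by (rule reduces_a2_r)
  also have "reduces\<^sup>*\<^sup>* \<dots> (a1', a2', b1', b2', r')"
    by (rule reduces_b1_r)
  finally show "specializes_to (a1', a2', b1', b2', r') (a1, a2, b1, b2, r)"
    unfolding specializes_to_def eq .
qed

lemma minimal_tuple_iff:
  "minimal_tuple (a1, a2, b1, b2, r) \<longleftrightarrow>
     (b1 = 0 \<or> r = 0) \<and> (a2 = 0 \<or> r = 0) \<and> (a2 = 0 \<or> b2 = 0) \<and> (a1 = 0 \<or> b1 = 0)"
proof -
  have "(\<exists>t'. reduces (a1, a2, b1, b2, r) t') \<longleftrightarrow>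
      b1 \<noteq> 0 \<and> r \<noteq> 0 \<or> a2 \<noteq> 0 \<and> r \<noteq> 0 \<or> a2 \<noteq> 0 \<and> b2 \<noteq> 0 \<or> a1 \<noteq> 0 \<and> b1 \<noteq> 0"
    (is "?L \<longleftrightarrow> ?R")
  proof
    show "?L \<Longrightarrow> ?R"
      by (auto elim: reduces.cases)
  next
    assume ?R
    then show ?L
      using reduces.intros(1)[of a1 a2 "b1 - 1" b2 "r - 1"]
        reduces.intros(2)[of a1 "a2 - 1" b1 b2 "r - 1"]
        reduces.intros(3)[of a1 "a2 - 1" b1 "b2 - 1" r]
        reduces.intros(4)[of "a1 - 1" a2 "b1 - 1" b2 r]
      by (elim disjE conjE) (auto simp del: One_nat_def split_paired_Ex)
  qed
  then show ?thesis
    unfolding minimal_tuple_def by blast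
qed

section \<open>Minimal tuples as lattice points\<close>

text \<open>The lower bounds on \<open>i\<close> and \<open>j\<close> express
  \<open>l \<le> a1\<close> and \<open>k \<le> b2\<close>. Subtraction being truncated,
  \<open>b1 - a1\<close> and \<open>a2 - b2\<close> are the positive parts \<open>hb1\<close> and
  \<open>ha2\<close> of \<open>N_B\<close>.\<close>

lemma minimal_specializing_last_nonzero:
  "{t \<in> minimal_specializing (a1, a2, b1, b2, r). last_entry t \<noteq> 0} =
     (\<lambda>(i, j). (a1 - (b1 - i), 0, 0, b2 - (a2 - j), r - i - j)) `
       {(i, j). b1 - a1 \<le> i \<and> i \<le> b1 \<and> a2 - b2 \<le> j \<and> j \<le> a2 \<and> i + j < r}"
  (is "?L = ?f ` ?R")
proof (intro equalityI subsetI)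
  fix t
  assume "t \<in> ?L"
  then obtain a1' a2' b1' b2' r' where t: "t = (a1', a2', b1', b2', r')"
    and r': "r' \<noteq> 0" and min: "minimal_tuple (a1', a2', b1', b2', r')"
    and spec: "specializes_to (a1', a2', b1', b2', r') (a1, a2, b1, b2, r)"
    by (cases t) (auto simp: minimal_specializing_def last_entry_def)
  have "a2' = 0" "b1' = 0"
    using min r' by (auto simp: minimal_tuple_iff)
  moreover obtain i j k l where
    "a1 = a1' + l" "a2 = a2' + j + k" "b1 = b1' + i + l" "b2 = b2' + k" "r = r' + i + j"
    using spec by (auto simp: specializes_to_iff)
  ultimately have "t = ?f (i, j)" "(i, j) \<in> ?R"
    using t r' by auto
  then show "t \<in> ?f ` ?R" by blast
next
  fix t
  assume "t \<in> ?f ` ?R"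
  then obtain i j where t: "t = (a1 - (b1 - i), 0, 0, b2 - (a2 - j), r - i - j)"
    and ij: "b1 - a1 \<le> i" "i \<le> b1" "a2 - b2 \<le> j" "j \<le> a2" "i + j < r"
    by auto
  have "specializes_to t (a1, a2, b1, b2, r)"
    unfolding t specializes_to_iff using ij
    by (intro exI[of _ i] exI[of _ j] exI[of _ "a2 - j"] exI[of _ "b1 - i"]) auto
  then show "t \<in> ?L"
    using ij by (simp add: t minimal_specializing_def minimal_tuple_iff last_entry_def)
qed

text \<open>Here \<open>j = r - i\<close>, and \<open>r - a2 \<le> i\<close> encodes
  \<open>j \<le> a2\<close>. Truncated subtraction yields exactly what the maximal choices
  \<open>k = min (a2 - j) b2\<close> and \<open>l = min (b1 - i) a1\<close> leave behind.\<close>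

lemma minimal_specializing_last_zero:
  "{t \<in> minimal_specializing (a1, a2, b1, b2, r). last_entry t = 0} =
     (\<lambda>i. (a1 - (b1 - i), a2 - (r - i) - b2, b1 - i - a1, b2 - (a2 - (r - i)), 0)) `
       {r - a2..min b1 r}"
  (is "?L = ?f ` ?R")
proof (intro equalityI subsetI)
  fix t
  assume "t \<in> ?L"
  then obtain a1' a2' b1' b2' where t: "t = (a1', a2', b1', b2', 0)"
    and min: "minimal_tuple (a1', a2', b1', b2', 0)"
    and spec: "specializes_to (a1', a2', b1', b2', 0) (a1, a2, b1, b2, r)"
    by (cases t) (auto simp: minimal_specializing_def last_entry_def)
  obtain i j k l where
    "a1 = a1' + l" "a2 = a2' + j + k" "b1 = b1' + i + l" "b2 = b2' + k" "r = i + j"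
    using spec by (auto simp: specializes_to_iff)
  then have "t = ?f i" "i \<in> ?R"
    using t min by (auto simp: minimal_tuple_iff)
  then show "t \<in> ?f ` ?R" by blast
next
  fix t
  assume "t \<in> ?f ` ?R"
  then obtain i where
    t: "t = (a1 - (b1 - i), a2 - (r - i) - b2, b1 - i - a1, b2 - (a2 - (r - i)), 0)"
    and i: "r - a2 \<le> i" "i \<le> b1" "i \<le> r"
    by auto
  have "specializes_to t (a1, a2, b1, b2, r)"
    unfolding t specializes_to_iff using i
    by (intro exI[of _ i] exI[of _ "r - i"] exI[of _ "min (a2 - (r - i)) b2"]
        exI[of _ "min (b1 - i) a1"]) auto
  then show "t \<in> ?L"
    by (auto simp: t minimal_specializing_def minimal_tuple_iff last_entry_def)
qed

section \<open>Counting lattice points in triangles and rectangles\<close>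

text \<open>Pascal's rule; for negative \<open>m\<close> both binomials vanish by convention, hence
  the \<open>max\<close>.\<close>

lemma binom_add_one_two: "binom (m + 1) 2 = binom m 2 + max 0 m"
proof (cases "m \<ge> 0")
  case True
  then obtain n where m: "m = int n"
    using nonneg_int_cases by blast
  have "binom (int q) 2 = int (q choose 2)" for q
    by (simp add: binom_def binomial_eq_0)
  from this[of n] this[of "Suc n"] show ?thesis
    by (simp add: m numeral_2_eq_2 add.commute)
qed (simp add: binom_def)

lemma finite_triangle: "finite {(i, j). x \<le> i \<and> y \<le> j \<and> i + j < (r :: nat)}"
  by (rule finite_subset[of _ "{..r} \<times> {..r}"]) auto

text \<open>Passing from \<open>r\<close> to \<open>r + 1\<close> adds the antidiagonal
  \<open>i + j = r\<close>, whose size is the increment in Pascal's rule.\<close>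

lemma card_triangle:
  "int (card {(i, j). x \<le> i \<and> y \<le> j \<and> i + j < (r :: nat)}) = binom (int r - int x - int y + 1) 2"
proof (induction r)
  case 0
  then show ?case by (simp add: binom_def)
next
  case (Suc r)
  let ?T = "\<lambda>r. {(i, j). x \<le> i \<and> y \<le> j \<and> i + j < (r :: nat)}"
  \<comment> \<open>The half-open interval is empty for \<open>y > r\<close>, whereas
    \<open>{x..r - y}\<close> would then contain 0 if \<open>x = 0\<close>, because of
    truncation.\<close>
  let ?D = "(\<lambda>i. (i, r - i)) ` {x..<r + 1 - y}"
  have "?T (Suc r) = ?T r \<union> ?D"
    by (auto simp: image_iff)
  moreover have "?T r \<inter> ?D = {}"
    by auto
  moreover have "card ?D = r + 1 - y - x"
    by (subst card_image) (auto simp: inj_on_def)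
  ultimately have "card (?T (Suc r)) = card (?T r) + (r + 1 - y - x)"
    using finite_triangle[of x y r] by (simp add: card_Un_disjoint)
  then show ?case
    using Suc.IH binom_add_one_two[of "int r - int x - int y + 1"]
    by (simp add: algebra_simps of_nat_diff max_def split: if_splits)
qed

text \<open>Inclusion-exclusion: from the triangle with corner \<open>(x, y)\<close> remove those
  with corners \<open>(p + 1, y)\<close> and \<open>(x, q + 1)\<close>, which meet in the one with
  corner \<open>(p + 1, q + 1)\<close>. These shifts by one account for the constants in the
  binomials.\<close>

lemma card_truncated_rectangle:
  fixes x y p q r :: nat
  assumes "x \<le> p" "y \<le> q"
  shows "int (card {(i, j). x \<le> i \<and> i \<le> p \<and> y \<le> j \<and> j \<le> q \<and> i + j < r}) =
    binom (int r - int x - int y + 1) 2 - binom (int r - int p - int y) 2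
      - binom (int r - int x - int q) 2 + binom (int r - int p - int q - 1) 2"
proof -
  let ?T = "\<lambda>x y. {(i, j). x \<le> i \<and> y \<le> j \<and> i + j < r}"
  let ?S = "{(i, j). x \<le> i \<and> i \<le> p \<and> y \<le> j \<and> j \<le> q \<and> i + j < r}"
  have fin: "finite (?T u v)" for u v
    by (rule finite_triangle)
  have "?T x y = ?S \<union> (?T (p + 1) y \<union> ?T x (q + 1))"
    using assms by auto
  moreover have "finite ?S"
    by (rule finite_subset[OF _ fin[of x y]]) auto
  ultimately have "card (?T x y) = card ?S + card (?T (p + 1) y \<union> ?T x (q + 1))"
    using fin[of "p + 1" y] fin[of x "q + 1"]
    by (subst card_Un_disjoint[symmetric]) auto
  moreover have "?T (p + 1) y \<inter> ?T x (q + 1) = ?T (p + 1) (q + 1)"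
    using assms by auto
  then have "card (?T (p + 1) y) + card (?T x (q + 1)) =
      card (?T (p + 1) y \<union> ?T x (q + 1)) + card (?T (p + 1) (q + 1))"
    using card_Un_Int[OF fin[of "p + 1" y] fin[of x "q + 1"]] by simp
  ultimately show ?thesis
    using card_triangle[of x y r] card_triangle[of "p + 1" y r]
      card_triangle[of x "q + 1" r] card_triangle[of "p + 1" "q + 1" r]
    by (simp add: algebra_simps)
qed

section \<open>The two counts and their sum\<close>

lemma card_minimal_specializing_last_nonzero:
  "int (card {t \<in> minimal_specializing (a1, a2, b1, b2, r). last_entry t \<noteq> 0})
     = N_B (a1, a2, b1, b2, r)"
proof -
  have "inj_on (\<lambda>(i, j). (a1 - (b1 - i), 0 :: nat, 0 :: nat, b2 - (a2 - j), r - i - j))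
      {(i, j). b1 - a1 \<le> i \<and> i \<le> b1 \<and> a2 - b2 \<le> j \<and> j \<le> a2 \<and> i + j < r}"
    \<comment> \<open>On this region \<open>b1 - i \<le> a1\<close> and
      \<open>a2 - j \<le> b2\<close>, so nothing is truncated and the first and fourth entries
      recover \<open>i\<close> and \<open>j\<close>.\<close>
    by (rule inj_on_inverseI[where g = "\<lambda>(a1', _, _, b2', _). (b1 - (a1 - a1'), a2 - (b2 - b2'))"])
      auto
  moreover have "int (b1 - a1) = max 0 (int b1 - int a1)" "int (a2 - b2) = max 0 (int a2 - int b2)"
    by auto
  ultimately show ?thesis
    using card_truncated_rectangle[of "b1 - a1" b1 "a2 - b2" a2 r]
    unfolding minimal_specializing_last_nonzero N_B_def Let_def
    by (simp add: card_image)
qed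

lemma card_minimal_specializing_last_zero:
  "int (card {t \<in> minimal_specializing (a1, a2, b1, b2, r). last_entry t = 0})
     = N_CM (a1, a2, b1, b2, r)"
proof -
  have "inj_on (\<lambda>i. (a1 - (b1 - i), a2 - (r - i) - b2, b1 - i - a1, b2 - (a2 - (r - i)), 0 :: nat))
      {r - a2..min b1 r}"
  \<comment> \<open>Put \<open>d = a2 - (r - i)\<close>. Either of \<open>d - b2\<close> and
    \<open>b2 - d\<close> may be truncated to 0, but together they determine \<open>d\<close>, and
    hence \<open>i\<close>.\<close>
  proof (rule inj_on_inverseI[where g = "\<lambda>(_, a2', _, b2', _). r - (a2 - (b2 + a2' - b2'))"])
    fix i
    assume "i \<in> {r - a2..min b1 r}"
    moreover have "b2 + (d - b2) - (b2 - d) = d" for d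
      by simp
    ultimately show "(case (a1 - (b1 - i), a2 - (r - i) - b2, b1 - i - a1, b2 - (a2 - (r - i)), 0 :: nat)
        of (_, a2', _, b2', _) \<Rightarrow> r - (a2 - (b2 + a2' - b2'))) = i"
      by auto
  qed
  then have "card {t \<in> minimal_specializing (a1, a2, b1, b2, r). last_entry t = 0}
      = Suc (min b1 r) - (r - a2)"
    unfolding minimal_specializing_last_zero by (simp only: card_image card_atLeastAtMost)
  \<comment> \<open>Truncation makes the length of the segment 0 when \<open>r > b1 + a2\<close>,
    the last case of \<open>N_CM\<close>.\<close>
  then show ?thesis
    by (simp add: N_CM_def min_def max_def)
qed

text \<open>The operations only decrease entries, so all tuples lie in a box. Finiteness lets the
  two counts be added.\<close>

lemma finite_minimal_specializing: "finite (minimal_specializing (a1, a2, b1, b2, r))"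
proof (rule finite_subset)
  show "minimal_specializing (a1, a2, b1, b2, r) \<subseteq> {..a1} \<times> {..a2} \<times> {..b1} \<times> {..b2} \<times> {..r}"
    by (auto simp: minimal_specializing_def specializes_to_iff)
qed auto

theorem proposition5p13:
  fixes J :: "'k::alg_closed_field R4 set"
    and a1 a2 b1 b2 r :: nat
  assumes "is_curve J"
    and "has_diameter_one J"
    and "is_five_tuple_of (a1, a2, b1, b2, r) J"
  shows "int (card (minimal_specializing (a1, a2, b1, b2, r)))
           = N_B (a1, a2, b1, b2, r) + N_CM (a1, a2, b1, b2, r)
       \<and> int (card {t \<in> minimal_specializing (a1, a2, b1, b2, r). last_entry t \<noteq> 0})
           = N_B (a1, a2, b1, b2, r)
       \<and> int (card {t \<in> minimal_specializing (a1, a2, b1, b2, r). last_entry t = 0})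
           = N_CM (a1, a2, b1, b2, r)"
proof -
  let ?M = "minimal_specializing (a1, a2, b1, b2, r)"
  have "card ?M = card ({t \<in> ?M. last_entry t \<noteq> 0} \<union> {t \<in> ?M. last_entry t = 0})"
    by (rule arg_cong[of _ _ card]) auto
  also have "\<dots> = card {t \<in> ?M. last_entry t \<noteq> 0} + card {t \<in> ?M. last_entry t = 0}"
    by (rule card_Un_disjoint) (auto simp: finite_minimal_specializing)
  finally show ?thesis
    unfolding card_minimal_specializing_last_nonzero[symmetric]
      card_minimal_specializing_last_zero[symmetric]
    by simp
qed

end
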